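(* In the equilibrium described in the context, misleading disclosure arises when $x\in\left[\frac{r_0\mu_0}{r},\bar{x}\right]$ for $r<r_0$, and when $x\in\left[\underline{x},\frac{r_0\mu_0}{r}\right]$ for $r>r_0$.
   Context: A firm has value $\theta=rx$, where $r$ and $x$ are independent. $r$ is a continuous variable on $\mathbb{R}^+$ with mean $r_0$; $x$ is a continuous variable on $\mathbb{R}$ with density $g$, cdf $G$ and mean $\mu_0>0$. An investor who has learned $r$ always discloses it in equilibrium. Conditional on having learned $r$, the investor also learns $x$ with probability $\beta$ ( *informed* ) and otherwise knows only $r$ ( *partially informed* ). Before disclosure the investor takes a position $\rho\in[-1,1]$ at price $P_1=E[\theta]=r_0\mu_0$. Then the informed investor either truthfully discloses $x$ along with $r$, or withholds $x$; the partially informed investor cannot disclose $x$. A report is *simple* if only $r$ is disclosed. Afterwards $\theta$ is revealed by other sources with probability $q$. The position is closed at price $P_2$: $P_2=rx$ if $x$ was disclosed or $\theta$ revealed; otherwise $P_2=r\mu_{ND}$, where $\mu_{ND}$ is the market's Bayesian posterior expectation of $x$ upon observing only $r$. The investor maximizes $E[\rho(P_2-P_1)]$ given their information. In the unique equilibrium, the informed investor withholds $x$ exactly when $x\in[\underline{x},\bar{x}]$. When $r<r_0$, the thresholds are uniquely determined by $\beta\int_{\underline{x}}^{\bar{x}}(G(x)-G(\bar{x}))dx-(1-\beta)(\mu_0-\underline{x})=0$ and $(1+q)\bar{x}+(1-q)\underline{x}=\frac{2r_0\mu_0}{r}$, and $\mu_{ND}=\underline{x}$. When $r>r_0$, they are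 uniquely determined by $\beta\int_{\underline{x}}^{\bar{x}}(G(x)-G(\underline{x}))dx-(1-\beta)(\mu_0-\bar{x})=0$ and $(1-q)\bar{x}+(1+q)\underline{x}=\frac{2r_0\mu_0}{r}$, and $\mu_{ND}=\bar{x}$. *Misleading disclosure:* the informed investor's simple report is misleading if it decreases (increases) the price when $rx>r_0\mu_0$ ($rx<r_0\mu_0$).
   Formalization: The point x = r_0μ_0/r is removed from both intervals, since there rx = r_0μ_0 and by the strict definition the report is not misleading; β<1 and q<1 are assumed, as otherwise the equilibrium is not well defined or not unique. *)

theory Defs
  imports "HOL-Probability.Probability"
begin

text \<open>
  The firm value is \<open>\<theta> = R X\<close>. The probability space describes an investor who has learned \<open>R\<close>
  (and hence discloses it); \<open>I\<close> is the event that the investor has learned \<open>X\<close> as well.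
  The bounds \<open>\<beta> < 1\<close> and \<open>q < 1\<close> are those under which the equilibrium is well defined and unique:
  for \<open>\<beta> = 1\<close> a report of \<open>R\<close> alone may have probability \<open>0\<close>, so that Bayes' rule is silent, and
  for \<open>q = 1\<close> an informed investor is always indifferent between disclosing and withholding.
\<close>

locale disclosure_model = prob_space M
  for M :: "'a measure"
    and R X :: "'a \<Rightarrow> real" and I :: "'a \<Rightarrow> bool"
    and f g :: "real \<Rightarrow> real" and \<beta> q :: real +
  assumes f_nonneg: "\<And>t. 0 \<le> f t"
    and R_density: "distributed M lborel R (\<lambda>t. ennreal (f t))"
    and R_pos: "AE \<omega> in M. 0 < R \<omega>"
    and R_integrable: "integrable M R"
    and g_nonneg: "\<And>x. 0 \<le> g x"
    and X_density: "distributed M lborel X (\<lambda>x. ennreal (g x))"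
    and X_integrable: "integrable M X"
    and X_mean_pos: "0 < expectation X"
    and indep_R_X: "indep_var borel R borel X"
    and I_event: "{\<omega> \<in> space M. I \<omega>} \<in> events"
    and indep_RX_I: "\<And>A. A \<in> sets (borel \<Otimes>\<^sub>M borel) \<Longrightarrow>
           indep_event {\<omega> \<in> space M. (R \<omega>, X \<omega>) \<in> A} {\<omega> \<in> space M. I \<omega>}"
    and prob_I: "prob {\<omega> \<in> space M. I \<omega>} = \<beta>"
    and beta_less_1: "\<beta> < 1"
    and q_nonneg: "0 \<le> q"
    and q_less_1: "q < 1"

definition initial_price :: "'a measure \<Rightarrow> ('a \<Rightarrow> real) \<Rightarrow> ('a \<Rightarrow> real) \<Rightarrow> real" where
  "initial_price M R X = prob_space.expectation M (\<lambda>\<omega>. R \<omega> * X \<omega>)"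

definition closing_price :: "real \<Rightarrow> real \<Rightarrow> real \<Rightarrow> bool \<Rightarrow> bool \<Rightarrow> real" where
  "closing_price r \<mu>ND x disclosed revealed =
     (if disclosed \<or> revealed then r * x else r * \<mu>ND)"

text \<open>
  Expected trading profit, over the revelation of \<open>\<theta>\<close>, of the position \<open>\<rho>\<close> opened at price \<open>P1\<close>,
  given the realisations \<open>r\<close> and \<open>x\<close>.
\<close>

definition profit :: "real \<Rightarrow> real \<Rightarrow> real \<Rightarrow> real \<Rightarrow> real \<Rightarrow> real \<Rightarrow> bool \<Rightarrow> real" where
  "profit q P1 r \<mu>ND x \<rho> disclosed =
     q * (\<rho> * (closing_price r \<mu>ND x disclosed True - P1)) +
     (1 - q) * (\<rho> * (closing_price r \<mu>ND x disclosed False - P1))"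

text \<open>
  The event that \<open>X\<close> is not disclosed when the informed investor withholds exactly the values in
  \<open>W\<close>, and the posterior mean of \<open>X\<close> given that event. Conditioning in addition on
  \<open>R = r\<close> has no effect, as \<open>R\<close> is independent of the pair \<open>(X, I)\<close>.
\<close>

definition simple_report :: "'a measure \<Rightarrow> ('a \<Rightarrow> real) \<Rightarrow> ('a \<Rightarrow> bool) \<Rightarrow> real set \<Rightarrow> 'a set" where
  "simple_report M X I W = {\<omega> \<in> space M. I \<omega> \<longrightarrow> X \<omega> \<in> W}"

definition posterior_mean :: "'a measure \<Rightarrow> ('a \<Rightarrow> real) \<Rightarrow> ('a \<Rightarrow> bool) \<Rightarrow> real set \<Rightarrow> real" where
  "posterior_mean M X I W =
     (LINT \<omega>:simple_report M X I W|M. X \<omega>) / measure M (simple_report M X I W)"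

text \<open>
  Equilibrium after \<open>R = r\<close> has been disclosed: \<open>pos_inf x\<close> is the position of the informed investor
  who knows \<open>x\<close>, \<open>pos_part\<close> that of the partially informed investor, \<open>W\<close> is the set of values that
  the informed investor withholds, and \<open>\<mu>ND\<close> is the market's expectation of \<open>X\<close> when it is not
  disclosed. The third conjunct is a convention for ties: an informed investor for whom withholding
  is also optimal withholds, which makes \<open>W\<close> closed.
\<close>

definition equilibrium ::
  "'a measure \<Rightarrow> ('a \<Rightarrow> real) \<Rightarrow> ('a \<Rightarrow> real) \<Rightarrow> ('a \<Rightarrow> bool) \<Rightarrow> real \<Rightarrow> real \<Rightarrow>
   (real \<Rightarrow> real) \<Rightarrow> real \<Rightarrow> real set \<Rightarrow> real \<Rightarrow> bool" where
  "equilibrium M R X I q r pos_inf pos_part W \<mu>ND \<longleftrightarrow>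
     (let u = profit q (initial_price M R X) r \<mu>ND in
        W \<in> sets borel \<and>
        (\<forall>x. pos_inf x \<in> {-1..1} \<and>
             (\<forall>\<rho>\<in>{-1..1}. \<forall>d. u x \<rho> d \<le> u x (pos_inf x) (x \<notin> W))) \<and>
        (\<forall>x. (\<exists>\<rho>\<in>{-1..1}. u x (pos_inf x) (x \<notin> W) \<le> u x \<rho> False) \<longrightarrow> x \<in> W) \<and>
        pos_part \<in> {-1..1} \<and>
        (\<forall>\<rho>\<in>{-1..1}. prob_space.expectation M (\<lambda>\<omega>. u (X \<omega>) \<rho> False)
                       \<le> prob_space.expectation M (\<lambda>\<omega>. u (X \<omega>) pos_part False)) \<and>
        \<mu>ND = posterior_mean M X I W)"

definition thresholds ::
  "(real \<Rightarrow> real) \<Rightarrow> real \<Rightarrow> real \<Rightarrow> real \<Rightarrow> real \<Rightarrow> real \<Rightarrow> real \<Rightarrow> real \<Rightarrow> bool" where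
  "thresholds G r0 \<mu>0 \<beta> q r xl xu \<longleftrightarrow>
     xl \<le> xu \<and>
     (r < r0 \<longrightarrow>
        \<beta> * integral {xl..xu} (\<lambda>x. G x - G xu) - (1 - \<beta>) * (\<mu>0 - xl) = 0 \<and>
        (1 + q) * xu + (1 - q) * xl = 2 * r0 * \<mu>0 / r) \<and>
     (r > r0 \<longrightarrow>
        \<beta> * integral {xl..xu} (\<lambda>x. G x - G xl) - (1 - \<beta>) * (\<mu>0 - xu) = 0 \<and>
        (1 - q) * xu + (1 + q) * xl = 2 * r0 * \<mu>0 / r)"

text \<open>
  The informed investor who knows \<open>x\<close> issues a simple report, and the price that results unless
  \<open>\<theta>\<close> is revealed moves away from \<open>P1\<close> in the direction opposite to \<open>r x\<close>.
\<close>

definition misleading ::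
  "'a measure \<Rightarrow> ('a \<Rightarrow> real) \<Rightarrow> ('a \<Rightarrow> real) \<Rightarrow> real \<Rightarrow> real set \<Rightarrow> real \<Rightarrow> real \<Rightarrow> bool" where
  "misleading M R X r W \<mu>ND x \<longleftrightarrow>
     (let P1 = initial_price M R X;
          P2 = closing_price r \<mu>ND x False False;
          v0 = prob_space.expectation M R * prob_space.expectation M X in
        x \<in> W \<and> (r * x > v0 \<and> P2 < P1 \<or> r * x < v0 \<and> P2 > P1))"

end

theory Submission
  imports Defs
begin

text \<open>
  Put \<open>c = r0 \<mu>0 / r\<close>. Up to the factor \<open>r\<close>, the best profit is \<open>\<bar>x - c\<bar>\<close> after disclosing and
  \<open>\<bar>q (x - c) + (1 - q) (\<mu>ND - c)\<bar>\<close> after withholding \<open>x\<close>, so the withheld values form an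
  interval around \<open>c\<close>, one end of which is \<open>\<mu>ND\<close>: the lower end if \<open>\<mu>ND \<le> c\<close>, the upper one
  otherwise. Bayes' rule puts \<open>\<mu>ND\<close> on the same side of \<open>c\<close> as \<open>\<mu>0\<close>, because a posterior mean that
  is the largest (smallest) withheld value cannot exceed (fall below) \<open>\<mu>0\<close>. By Fubini, Bayes' rule is
  the integral equation for the thresholds; the expected excess over the lower end of
  the interval is monotone in that end, hence the solution is unique and the withheld interval is
  the one between the thresholds. A simple report thus moves the price to \<open>r \<mu>ND\<close>, which misleads
  exactly on the part of the interval on the other side of \<open>c\<close>.
\<close>

section \<open>Optimal withholding by the informed investor\<close>

text \<open>Squaring turns the comparison into the sign of
  \<open>(1 - q) * (y - d) * ((1 + q) * y + (1 - q) * d)\<close>. Its roots in \<open>y\<close>,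
  \<open>d\<close> and \<open>- (1 - q) * d / (1 + q)\<close>, lie on opposite sides of
  \<open>0\<close> unless \<open>d = 0\<close>, so the sign of \<open>d\<close> decides which one is
  the lower end.\<close>

lemma abs_le_mixture_iff:
  fixes y d q :: real
  assumes "0 \<le> q" "q < 1"
  shows "\<bar>y\<bar> \<le> \<bar>q * y + (1 - q) * d\<bar> \<longleftrightarrow>
    (if d \<le> 0 then d \<le> y \<and> (1 + q) * y \<le> - (1 - q) * d
     else y \<le> d \<and> - (1 - q) * d \<le> (1 + q) * y)"
proof -
  have "\<bar>y\<bar> \<le> \<bar>q * y + (1 - q) * d\<bar> \<longleftrightarrow> y\<^sup>2 \<le> (q * y + (1 - q) * d)\<^sup>2"
    by (rule abs_le_square_iff)
  also have "\<dots> \<longleftrightarrow> (1 - q) * ((y - d) * ((1 + q) * y + (1 - q) * d)) \<le> 0"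
    by (simp add: power2_eq_square algebra_simps)
  also have "\<dots> \<longleftrightarrow> (y - d) * ((1 + q) * y + (1 - q) * d) \<le> 0"
    using assms by (simp add: mult_le_0_iff)
  also have "\<dots> \<longleftrightarrow> (if d \<le> 0 then d \<le> y \<and> (1 + q) * y \<le> - (1 - q) * d
     else y \<le> d \<and> - (1 - q) * d \<le> (1 + q) * y)"
  proof -
    define p where "p = (1 + q) * y + (1 - q) * d"
    have p: "(1 + q) * y \<le> - (1 - q) * d \<longleftrightarrow> p \<le> 0" "- (1 - q) * d \<le> (1 + q) * y \<longleftrightarrow> 0 \<le> p"
      by (auto simp: p_def algebra_simps)
    \<comment> \<open>Hence \<open>p - 2 * d\<close> has the sign of \<open>y - d\<close>. For
      \<open>d \<le> 0\<close> this rules out \<open>y < d\<close>, where both factors would be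
      negative; for \<open>d > 0\<close> it rules out \<open>y > d\<close>, where both would be
      positive.\<close>
    have eq: "p = (1 + q) * (y - d) + 2 * d"
      by (simp add: p_def algebra_simps)
    have "p > 2 * d" if "y > d" using that assms by (simp add: eq)
    moreover have "p < 2 * d" if "y < d" using that assms by (simp add: eq mult_less_0_iff)
    moreover have "p = 2 * d" if "y = d" using that by (simp add: eq)
    ultimately show ?thesis unfolding p_def[symmetric] p
      by (cases y d rule: linorder_cases) (auto simp: mult_le_0_iff)
  qed
  finally show ?thesis .
qed

lemma profit_disclosed: "profit q P1 r m x \<rho> True = \<rho> * (r * x - P1)"
  by (simp add: profit_def closing_price_def algebra_simps)

lemma profit_withheld:
  "profit q P1 r m x \<rho> False = \<rho> * (q * (r * x) + (1 - q) * (r * m) - P1)"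
  by (simp add: profit_def closing_price_def algebra_simps)

lemma mult_le_abs_of_unit: "\<rho> \<in> {-1..1} \<Longrightarrow> \<rho> * t \<le> \<bar>t::real\<bar>"
  using mult_right_mono[of "\<bar>\<rho>\<bar>" 1 "\<bar>t\<bar>"] abs_le_D1[of "\<rho> * t" "\<bar>t\<bar>"]
  by (simp add: abs_mult abs_le_iff)

lemma sgn_unit: "sgn (t::real) \<in> {-1..1}"
  by (simp add: sgn_real_def)

lemma sgn_mult_self: "sgn t * t = \<bar>t::real\<bar>"
  by (simp add: abs_sgn mult.commute)

text \<open>Profit is linear in the position, so the sign of the margin is an optimal position and
  earns its absolute value. Optimality against a disclosing deviation gives one direction, the tie
  convention the other.\<close>

lemma equilibrium_withholding_iff:
  assumes eq: "equilibrium M R X I q r pos_inf pos_part W m"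
    and "0 < r" "0 \<le> q" "q < 1"
  defines "c \<equiv> initial_price M R X / r"
  shows "x \<in> W \<longleftrightarrow> \<bar>x - c\<bar> \<le> \<bar>q * (x - c) + (1 - q) * (m - c)\<bar>"
proof -
  let ?P = "initial_price M R X"
  let ?u = "profit q ?P r m"
  let ?D = "r * x - ?P" and ?N = "q * (r * x) + (1 - q) * (r * m) - ?P"
  have opt: "?u x \<rho> d \<le> ?u x (pos_inf x) (x \<notin> W)" if "\<rho> \<in> {-1..1}" for \<rho> d
    using eq that by (auto simp: equilibrium_def Let_def)
  have pos: "pos_inf x \<in> {-1..1}"
    using eq by (auto simp: equilibrium_def Let_def)
  have tie: "x \<in> W" if "\<rho> \<in> {-1..1}" "?u x (pos_inf x) (x \<notin> W) \<le> ?u x \<rho> False" for \<rho>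
    using eq that unfolding equilibrium_def Let_def by blast
  have "x \<in> W \<longleftrightarrow> \<bar>?D\<bar> \<le> \<bar>?N\<bar>"
  proof
    assume "x \<in> W"
    then have "\<bar>?D\<bar> \<le> pos_inf x * ?N"
      using opt[OF sgn_unit[of ?D], of True]
      by (simp add: profit_disclosed profit_withheld sgn_mult_self)
    also have "\<dots> \<le> \<bar>?N\<bar>" by (rule mult_le_abs_of_unit[OF pos])
    finally show "\<bar>?D\<bar> \<le> \<bar>?N\<bar>" .
  next
    assume le: "\<bar>?D\<bar> \<le> \<bar>?N\<bar>"
    show "x \<in> W"
    proof (rule ccontr)
      assume "x \<notin> W"
      moreover from this have "?u x (pos_inf x) (x \<notin> W) \<le> ?u x (sgn ?N) False"
        using mult_le_abs_of_unit[OF pos, of ?D] le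
        by (simp add: profit_disclosed profit_withheld sgn_mult_self)
      ultimately show False using tie[OF sgn_unit] by blast
    qed
  qed
  moreover have "?D = r * (x - c)" "?N = r * (q * (x - c) + (1 - q) * (m - c))"
    using \<open>0 < r\<close> by (simp_all add: c_def field_simps)
  ultimately show ?thesis
    using \<open>0 < r\<close> by (simp only: abs_mult) simp
qed

section \<open>Truncated expectations and uniqueness of the thresholds\<close>

text \<open>Fubini for the region \<open>l \<le> x < y \<le> b\<close>.\<close>

lemma integral_truncated_cdf:
  fixes N :: "real measure"
  assumes "real_distribution N" and "l \<le> b"
  shows "(LINT y|N. (y - l) * indicator {l..b} y) = integral {l..b} (\<lambda>x. cdf N b - cdf N x)"
proof -
  interpret real_distribution N by fact
  interpret P: pair_sigma_finite N lborel ..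
  \<comment> \<open>The strict inequality \<open>x < y\<close> makes the section at
    \<open>x \<ge> l\<close> the interval \<open>{x<..b}\<close>, whose mass is a cdf difference
    even if \<open>N\<close> has atoms; the section at \<open>y\<close> in \<open>{l..b}\<close> has
    length \<open>y - l\<close>.\<close>
  let ?S = "{p::real\<times>real. l \<le> snd p \<and> snd p < fst p \<and> fst p \<le> b}"
  let ?f = "\<lambda>y x. indicator ?S (y, x) :: real"
  have borel_prod: "sets (N \<Otimes>\<^sub>M lborel) = sets (borel \<Otimes>\<^sub>M borel)"
    by (intro sets_pair_measure_cong) (simp_all add: events_eq_borel)
  have S: "?S \<in> sets (N \<Otimes>\<^sub>M lborel)"
  proof -
    have "Measurable.pred (borel \<Otimes>\<^sub>M borel)
        (\<lambda>p::real\<times>real. l \<le> snd p \<and> snd p < fst p \<and> fst p \<le> b)" by measurable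
    then have "?S \<in> sets (borel \<Otimes>\<^sub>M borel)" by (simp add: pred_def space_pair_measure)
    then show ?thesis by (simp add: borel_prod)
  qed
  have "emeasure (N \<Otimes>\<^sub>M lborel) ?S \<le> emeasure (N \<Otimes>\<^sub>M lborel) (space N \<times> {l..b})"
    by (rule emeasure_mono) auto
  also have "\<dots> = emeasure N (space N) * emeasure lborel {l..b}"
    by (rule lborel.emeasure_pair_measure_Times) simp_all
  also have "\<dots> < \<infinity>" using \<open>l \<le> b\<close> by (simp add: emeasure_space_1 del: space_eq_univ)
  finally have fin: "emeasure (N \<Otimes>\<^sub>M lborel) ?S < \<infinity>" .
  have int: "integrable (N \<Otimes>\<^sub>M lborel) (case_prod ?f)"
    using integrable_real_indicator[OF S fin] by (simp add: case_prod_unfold)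
  have inner: "(LINT y|N. ?f y x) = indicator {l..b} x *\<^sub>R (cdf N b - cdf N x)" for x
  proof -
    have *: "(\<lambda>y. ?f y x) = indicator (if l \<le> x then {x<..b} else {})"
      by (auto simp: indicator_def)
    show ?thesis
      unfolding * using cdf_diff_eq[of x b] by (cases "x < b") (auto simp: indicator_def)
  qed
  have "(LINT y|N. (y - l) * indicator {l..b} y) = (LINT y|N. (LINT x|lborel. ?f y x))"
  proof (rule Bochner_Integration.integral_cong[OF refl])
    fix y
    have *: "(\<lambda>x. ?f y x) = indicator (if y \<le> b then {l..<y} else {})"
      by (auto simp: indicator_def)
    show "(y - l) * indicator {l..b} y = (LINT x|lborel. ?f y x)"
      unfolding * by (cases "l \<le> y"; cases "y \<le> b") simp_all
  qed
  also have "\<dots> = (LINT x|lborel. (LINT y|N. ?f y x))"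
    by (rule P.Fubini_integral[OF int, symmetric])
  also have "\<dots> = (LINT x:{l..b}|lborel. cdf N b - cdf N x)"
    unfolding set_lebesgue_integral_def by (simp only: inner)
  also have "\<dots> = integral {l..b} (\<lambda>x. cdf N b - cdf N x)"
    using P.integrable_snd[OF int]
    by (intro set_borel_integral_eq_integral(2)) (simp only: set_integrable_def inner)
  finally show ?thesis .
qed

text \<open>Bayes' rule and the threshold equations both take this shape, with the two ends tied by
  the same line; this identifies the equilibrium interval with the one between the
  thresholds.\<close>

lemma (in prob_space) threshold_unique:
  fixes X :: "'a \<Rightarrow> real"
  assumes X: "integrable M X" and "0 \<le> \<beta>" "\<beta> < 1" "0 \<le> k"
    and eq1: "(1 - \<beta>) * (expectation X - l1) + \<beta> * (LINT \<omega>|M. (X \<omega> - l1) * indicator {l1..b1} (X \<omega>)) = 0"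
    and eq2: "(1 - \<beta>) * (expectation X - l2) + \<beta> * (LINT \<omega>|M. (X \<omega> - l2) * indicator {l2..b2} (X \<omega>)) = 0"
    and line: "b1 + k * l1 = b2 + k * l2"
  shows "l1 = l2"
proof -
  \<comment> \<open>A larger lower end comes with a smaller upper end and hence a smaller truncated excess.\<close>
  have False
    if "l < l'" and line: "b + k * l = b' + k * l'"
      and e: "(1 - \<beta>) * (expectation X - l) + \<beta> * (LINT \<omega>|M. (X \<omega> - l) * indicator {l..b} (X \<omega>)) = 0"
      and e': "(1 - \<beta>) * (expectation X - l') + \<beta> * (LINT \<omega>|M. (X \<omega> - l') * indicator {l'..b'} (X \<omega>)) = 0"
    for l b l' b'
  proof -
    have "k * l \<le> k * l'" using \<open>l < l'\<close> \<open>0 \<le> k\<close> by (simp add: mult_left_mono)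
    then have "b' \<le> b" using line by linarith
    have int: "integrable M (\<lambda>\<omega>. (X \<omega> - a) * indicator {a..u} (X \<omega>))" for a u
    proof (rule Bochner_Integration.integrable_bound)
      show "integrable M (\<lambda>\<omega>. X \<omega> - a)" using X by simp
      show "(\<lambda>\<omega>. (X \<omega> - a) * indicator {a..u} (X \<omega>)) \<in> borel_measurable M"
        using borel_measurable_integrable[OF X] by measurable
    qed (simp add: indicator_def)
    have "(LINT \<omega>|M. (X \<omega> - l') * indicator {l'..b'} (X \<omega>))
        \<le> (LINT \<omega>|M. (X \<omega> - l) * indicator {l..b} (X \<omega>))"
      by (intro integral_mono int) (use \<open>l < l'\<close> \<open>b' \<le> b\<close> in \<open>auto simp: indicator_def\<close>)
    then have "\<beta> * (LINT \<omega>|M. (X \<omega> - l') * indicator {l'..b'} (X \<omega>))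
        \<le> \<beta> * (LINT \<omega>|M. (X \<omega> - l) * indicator {l..b} (X \<omega>))"
      using \<open>0 \<le> \<beta>\<close> by (rule mult_left_mono)
    \<comment> \<open>Since \<open>\<beta> < 1\<close>, this term is strictly decreasing in the
      lower end, so the two left-hand sides cannot both vanish.\<close>
    moreover have "(1 - \<beta>) * (expectation X - l') < (1 - \<beta>) * (expectation X - l)"
      using \<open>l < l'\<close> \<open>\<beta> < 1\<close> by simp
    ultimately show False using e e' by linarith
  qed
  from this[OF _ line eq1 eq2] this[OF _ line[symmetric] eq2 eq1]
  show ?thesis by (cases l1 l2 rule: linorder_cases) auto
qed

section \<open>Independence of \<open>X\<close> from being informed\<close>

context disclosure_model
begin

lemma X_measurable [measurable]: "X \<in> borel_measurable M"
  using X_integrable by auto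

lemma I_measurable [measurable]: "Measurable.pred M I"
  using I_event by (simp add: pred_def)

lemma beta_nonneg: "0 \<le> \<beta>"
  using prob_I measure_nonneg by metis

text \<open>Encoding the event as a 0-1 variable makes the product rule for expectations of
  independent variables applicable to it.\<close>

lemma indep_var_X_I: "indep_var borel X borel (\<lambda>\<omega>. of_bool (I \<omega>) :: real)"
proof -
  let ?Z = "\<lambda>\<omega>. of_bool (I \<omega>) :: real"
  let ?C = "{X -` A \<inter> space M |A. A \<in> sets borel}"
  let ?D = "{?Z -` A \<inter> space M |A. A \<in> sets borel}"
  have Z [measurable]: "?Z \<in> borel_measurable M" by measurable
  have indep_I: "prob (X -` A \<inter> space M \<inter> {\<omega> \<in> space M. I \<omega>}) = prob (X -` A \<inter> space M) * \<beta>"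
    if "A \<in> sets borel" for A
  proof -
    \<comment> \<open>The full first factor drops \<open>R\<close> from the condition on the
      pair.\<close>
    have "UNIV \<times> A \<in> sets (borel \<Otimes>\<^sub>M borel)"
      using that by (intro pair_measureI) auto
    let ?P = "{\<omega> \<in> space M. (R \<omega>, X \<omega>) \<in> UNIV \<times> A}" and ?E = "{\<omega> \<in> space M. I \<omega>}"
    note indep_RX_I[OF \<open>UNIV \<times> A \<in> sets (borel \<Otimes>\<^sub>M borel)\<close>, unfolded indep_event_def indep_events_def, THEN conjunct2, rule_format, of UNIV]
    then have "prob (\<Inter>b\<in>UNIV. case_bool ?P ?E b) = (\<Prod>b\<in>UNIV. prob (case_bool ?P ?E b))"
      by simp
    then have "prob (?P \<inter> ?E) = prob ?P * \<beta>"
      unfolding prob_I[symmetric] by (simp add: UNIV_bool ac_simps)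
    moreover have "?P = X -` A \<inter> space M" by auto
    ultimately show ?thesis by simp
  qed
  have "indep_set ?C ?D"
    unfolding indep_sets2_eq
  proof safe
    fix A B :: "real set" assume A: "A \<in> sets borel" and B: "B \<in> sets borel"
    let ?E = "{\<omega> \<in> space M. I \<omega>}" and ?V = "X -` A \<inter> space M"
    show "prob (?V \<inter> (?Z -` B \<inter> space M)) = prob ?V * prob (?Z -` B \<inter> space M)"
    proof -
      have V: "?V \<in> events" using A by measurable
      have "?V - ?E = ?V - ?V \<inter> ?E" by auto
      then have co: "prob (?V \<inter> (space M - ?E)) = prob ?V * prob (space M - ?E)"
        using indep_I[OF A] finite_measure_Diff[OF V, of "?V \<inter> ?E"] V I_event prob_compl[OF I_event]
        by (subst Int_Diff[symmetric]) (auto simp: prob_I Int_absorb2 right_diff_distrib)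
      \<comment> \<open>The preimage under a 0-1 variable depends only on which of \<open>0\<close>
        and \<open>1\<close> lie in \<open>B\<close>, so the event, its complement and the two
        trivial cases suffice.\<close>
      have "?Z -` B \<inter> space M = (if 1 \<in> B then ?E else {}) \<union> (if 0 \<in> B then space M - ?E else {})"
        by (auto simp: of_bool_def split: if_splits)
      moreover have "?E \<union> (space M - ?E) = space M" "?V \<inter> space M = ?V" by auto
      ultimately show ?thesis
        using co indep_I[OF A] by (simp add: prob_I prob_space)
    qed
  qed (use measurable_sets[OF X_measurable] measurable_sets[OF Z] in auto)
  moreover have "Int_stable {f -` A \<inter> space M |A. A \<in> sets borel}" for f :: "'a \<Rightarrow> real"
    unfolding Int_stable_def
  proof safe
    fix A B :: "real set" assume "A \<in> sets borel" "B \<in> sets borel"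
    then show "\<exists>C. f -` A \<inter> space M \<inter> (f -` B \<inter> space M) = f -` C \<inter> space M \<and> C \<in> sets borel"
      by (intro exI[of _ "A \<inter> B"]) auto
  qed
  ultimately show ?thesis
    unfolding indep_var_eq by (auto intro!: indep_set_sigma_sets Z)
qed

lemma expectation_informed:
  fixes h :: "real \<Rightarrow> real"
  assumes [measurable]: "h \<in> borel_measurable borel" and h: "integrable M (\<lambda>\<omega>. h (X \<omega>))"
  shows "(LINT \<omega>|M. h (X \<omega>) * of_bool (I \<omega>)) = expectation (\<lambda>\<omega>. h (X \<omega>)) * \<beta>"
    and "integrable M (\<lambda>\<omega>. h (X \<omega>) * of_bool (I \<omega>))"
proof -
  have eq: "(\<lambda>\<omega>. of_bool (I \<omega>) :: real) = (\<lambda>\<omega>. indicator {\<omega>. I \<omega>} \<omega>)"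
    by (auto simp: indicator_def)
  have I: "integrable M (\<lambda>\<omega>. of_bool (I \<omega>) :: real)"
    by (rule integrable_const_bound[of _ 1]) auto
  have EI: "expectation (\<lambda>\<omega>. of_bool (I \<omega>) :: real) = \<beta>"
    unfolding eq using prob_I by (simp add: Int_def conj_commute)
  have iv: "indep_var borel (\<lambda>\<omega>. h (X \<omega>)) borel (\<lambda>\<omega>. of_bool (I \<omega>) :: real)"
    using indep_var_compose[OF indep_var_X_I, of h borel "\<lambda>x. x" borel, OF assms(1)]
    by (simp add: comp_def)
  show "(LINT \<omega>|M. h (X \<omega>) * of_bool (I \<omega>)) = expectation (\<lambda>\<omega>. h (X \<omega>)) * \<beta>"
    using indep_var_lebesgue_integral[OF iv h I] EI by simp
  show "integrable M (\<lambda>\<omega>. h (X \<omega>) * of_bool (I \<omega>))"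
    by (rule indep_var_integrable[OF iv h I])
qed

lemma initial_price_eq: "initial_price M R X = expectation R * expectation X"
  unfolding initial_price_def
  by (rule indep_var_lebesgue_integral[OF indep_R_X R_integrable X_integrable])

section \<open>Bayes' rule as an integral equation\<close>

lemma integrable_excess: "W \<in> sets borel \<Longrightarrow> integrable M (\<lambda>\<omega>. (X \<omega> - m) * indicator W (X \<omega>))"
  by (rule Bochner_Integration.integrable_bound[of _ "\<lambda>\<omega>. X \<omega> - m"])
     (simp_all add: X_integrable indicator_def)

text \<open>Bayes' rule without its denominator says that \<open>X - m\<close> integrates to
  \<open>0\<close> over the simple reports. Their complement is \<open>I\<close> together with
  \<open>X\<close> outside \<open>W\<close>, where independence produces the factor
  \<open>\<beta>\<close>; splitting the whole space into \<open>W\<close> and its complement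
  regroups the terms.\<close>

lemma posterior_mean_eq:
  assumes W [measurable]: "W \<in> sets borel" and m: "m = posterior_mean M X I W"
  shows "(1 - \<beta>) * (expectation X - m) + \<beta> * (LINT \<omega>|M. (X \<omega> - m) * indicator W (X \<omega>)) = 0"
proof -
  let ?S = "simple_report M X I W"
  have S: "?S \<in> events" unfolding simple_report_def by measurable
  \<comment> \<open>A partially informed investor always issues a simple report, so such a report
    has probability at least \<open>1 - \<beta> > 0\<close> and the quotient in
    \<open>posterior_mean\<close> is a genuine one.\<close>
  have "1 - \<beta> = prob (space M - {\<omega> \<in> space M. I \<omega>})"
    using prob_compl[OF I_event] prob_I by simp
  also have "\<dots> \<le> prob ?S"
    by (rule finite_measure_mono[OF _ S]) (auto simp: simple_report_def)
  finally have pos: "0 < prob ?S" using beta_less_1 by linarith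
  have Xm: "integrable M (\<lambda>\<omega>. X \<omega> - m)" using X_integrable by simp
  have "integrable M (\<lambda>\<omega>. indicator ?S \<omega> * X \<omega>)"
    using integrable_mult_indicator[OF S X_integrable] by simp
  moreover have "integrable M (\<lambda>\<omega>. indicator ?S \<omega> * m)"
    using integrable_mult_indicator[OF S, of "\<lambda>_. m"] by simp
  ultimately have "(LINT \<omega>|M. indicator ?S \<omega> * X \<omega> - indicator ?S \<omega> * m)
      = (LINT \<omega>|M. indicator ?S \<omega> * X \<omega>) - (LINT \<omega>|M. indicator ?S \<omega> * m)"
    by (rule Bochner_Integration.integral_diff)
  also have "(LINT \<omega>|M. indicator ?S \<omega> * X \<omega>) = m * prob ?S"
    using pos m by (simp add: posterior_mean_def set_lebesgue_integral_def)
  also have "(LINT \<omega>|M. indicator ?S \<omega> * m) = prob ?S * m"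
    using sets.sets_into_space[OF S] by (simp add: Int_absorb2)
  finally have "0 = (LINT \<omega>|M. indicator ?S \<omega> * X \<omega> - indicator ?S \<omega> * m)"
    by simp
  also have "\<dots> = (LINT \<omega>|M. (X \<omega> - m) - ((X \<omega> - m) * indicator (- W) (X \<omega>)) * of_bool (I \<omega>))"
    by (rule Bochner_Integration.integral_cong[OF refl])
       (simp add: simple_report_def indicator_def of_bool_def)
  also have "\<dots> = expectation (\<lambda>\<omega>. X \<omega> - m)
      - (LINT \<omega>|M. ((X \<omega> - m) * indicator (- W) (X \<omega>)) * of_bool (I \<omega>))"
    by (intro Bochner_Integration.integral_diff Xm
        expectation_informed(2)[of "\<lambda>x. (x - m) * indicator (- W) x"] integrable_excess) measurable
  also have "(LINT \<omega>|M. ((X \<omega> - m) * indicator (- W) (X \<omega>)) * of_bool (I \<omega>))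
      = expectation (\<lambda>\<omega>. (X \<omega> - m) * indicator (- W) (X \<omega>)) * \<beta>"
    by (intro expectation_informed(1)[of "\<lambda>x. (x - m) * indicator (- W) x"] integrable_excess) measurable
  also have "expectation (\<lambda>\<omega>. (X \<omega> - m) * indicator (- W) (X \<omega>))
      = (LINT \<omega>|M. (X \<omega> - m) - (X \<omega> - m) * indicator W (X \<omega>))"
    by (rule Bochner_Integration.integral_cong[OF refl]) (auto simp: indicator_def)
  also have "\<dots> = expectation (\<lambda>\<omega>. X \<omega> - m) - (LINT \<omega>|M. (X \<omega> - m) * indicator W (X \<omega>))"
    by (intro Bochner_Integration.integral_diff Xm integrable_excess W)
  also have "expectation (\<lambda>\<omega>. X \<omega> - m) = expectation X - m"
    using X_integrable by (simp add: prob_space)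
  finally show ?thesis by (simp add: algebra_simps)
qed

section \<open>Truncated expectations of \<open>X\<close> as integrals of its cdf\<close>

text \<open>Brings the truncated term of Bayes' rule into the form of the threshold equation for
  \<open>r < r0\<close>.\<close>

lemma expectation_excess_eq:
  assumes "l \<le> b"
  shows "(LINT \<omega>|M. (X \<omega> - l) * indicator {l..b} (X \<omega>))
    = - integral {l..b} (\<lambda>x. cdf (distr M borel X) x - cdf (distr M borel X) b)"
proof -
  have "(LINT \<omega>|M. (X \<omega> - l) * indicator {l..b} (X \<omega>))
      = (LINT y|distr M borel X. (y - l) * indicator {l..b} y)"
    by (subst integral_distr) simp_all
  also have "\<dots> = integral {l..b} (\<lambda>x. cdf (distr M borel X) b - cdf (distr M borel X) x)"
    by (rule integral_truncated_cdf[OF real_distribution_distr assms]) simp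
  also have "\<dots> = - integral {l..b} (\<lambda>x. cdf (distr M borel X) x - cdf (distr M borel X) b)"
    by (subst integral_neg[symmetric]) simp
  finally show ?thesis .
qed

lemma prob_X_interval:
  assumes "l \<le> b"
  shows "prob (X -` {l..b} \<inter> space M) = cdf (distr M borel X) b - cdf (distr M borel X) l"
proof -
  interpret D: real_distribution "distr M borel X" by simp
  \<comment> \<open>Since \<open>X\<close> has a density, the left end carries no mass.\<close>
  have "emeasure M (X -` {l} \<inter> space M) = (\<integral>\<^sup>+ x. ennreal (g x) * indicator {l} x \<partial>lborel)"
    by (rule distributed_emeasure[OF X_density]) simp
  also have "\<dots> = 0"
    by (subst nn_integral_0_iff_AE) (use AE_lborel_singleton[of l] distributed_borel_measurable[OF X_density] in \<open>auto elim!: eventually_mono\<close>)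
  finally have "prob (X -` {l} \<inter> space M) = 0" by (simp add: measure_def)
  moreover have "X -` {l..b} \<inter> space M = (X -` {l} \<inter> space M) \<union> (X -` {l<..b} \<inter> space M)"
    using assms by auto
  moreover have "prob (X -` {l<..b} \<inter> space M) = measure (distr M borel X) {l<..b}"
    by (simp add: measure_distr)
  ultimately show ?thesis
    using D.cdf_diff_eq[of l b] assms
      finite_measure_Union[of "X -` {l} \<inter> space M" "X -` {l<..b} \<inter> space M"]
    by (cases "l = b") (auto simp: disjoint_iff)
qed

text \<open>The form needed for \<open>r > r0\<close>. On the interval,
  \<open>X - b = (X - l) - (b - l)\<close>, so the excess is corrected by \<open>b - l\<close> times
  the probability of the interval; that product is the integral of a constant, and the two integrals
  add up.\<close>

lemma expectation_shortfall_eq: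
  assumes "l \<le> b"
  shows "(LINT \<omega>|M. (X \<omega> - b) * indicator {l..b} (X \<omega>))
    = - integral {l..b} (\<lambda>x. cdf (distr M borel X) x - cdf (distr M borel X) l)"
proof -
  let ?G = "cdf (distr M borel X)"
  interpret D: real_distribution "distr M borel X" by simp
  have "(LINT \<omega>|M. (X \<omega> - b) * indicator {l..b} (X \<omega>))
      = (LINT \<omega>|M. (X \<omega> - l) * indicator {l..b} (X \<omega>) - (b - l) * indicator (X -` {l..b} \<inter> space M) \<omega>)"
    by (rule Bochner_Integration.integral_cong[OF refl]) (auto simp: indicator_def)
  also have "\<dots> = (LINT \<omega>|M. (X \<omega> - l) * indicator {l..b} (X \<omega>)) - (b - l) * (?G b - ?G l)"
    unfolding prob_X_interval[OF assms, symmetric]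
    by (subst Bochner_Integration.integral_diff[OF integrable_excess])
       (auto simp: less_top[symmetric])
  also have "\<dots> = - (integral {l..b} (\<lambda>x. ?G x - ?G b) + integral {l..b} (\<lambda>x. ?G b - ?G l))"
    unfolding expectation_excess_eq[OF assms] using assms by simp
  also have "integral {l..b} (\<lambda>x. ?G x - ?G b) + integral {l..b} (\<lambda>x. ?G b - ?G l)
      = integral {l..b} (\<lambda>x. ?G x - ?G l)"
  proof -
    have "?G integrable_on {l..b}"
      by (rule integrable_on_mono_on) (auto simp: mono_on_def intro: D.cdf_nondecreasing)
    then have "(\<lambda>x. ?G x - ?G b) integrable_on {l..b}"
      by (intro integrable_diff integrable_const_ivl)
    then show ?thesis
      by (subst integral_add[symmetric]) auto
  qed
  finally show ?thesis .
qed

section \<open>Shape of the withheld set and location of the posterior mean\<close>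

text \<open>The end other than \<open>m\<close> solves
  \<open>(1 + q) * x + (1 - q) * m = 2 * c\<close>, which is the linear threshold condition.\<close>

lemma withholding_set:
  assumes eq: "equilibrium M R X I q r pos_inf pos_part W m" and "0 < r"
  defines "c \<equiv> expectation R * expectation X / r"
  shows "if m \<le> c then W = {m..(2 * c - (1 - q) * m) / (1 + q)}
         else W = {(2 * c - (1 - q) * m) / (1 + q)..m}"
proof -
  have "x \<in> W \<longleftrightarrow> (if m - c \<le> 0 then m - c \<le> x - c \<and> (1 + q) * (x - c) \<le> - (1 - q) * (m - c)
     else x - c \<le> m - c \<and> - (1 - q) * (m - c) \<le> (1 + q) * (x - c))" for x
    unfolding equilibrium_withholding_iff[OF eq \<open>0 < r\<close> q_nonneg q_less_1] initial_price_eq c_def[symmetric]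
    by (rule abs_le_mixture_iff[OF q_nonneg q_less_1])
  moreover have "(1 + q) * (x - c) \<le> - (1 - q) * (m - c) \<longleftrightarrow> x \<le> (2 * c - (1 - q) * m) / (1 + q)"
    "- (1 - q) * (m - c) \<le> (1 + q) * (x - c) \<longleftrightarrow> (2 * c - (1 - q) * m) / (1 + q) \<le> x" for x
    using q_nonneg by (simp_all add: pos_le_divide_eq pos_divide_le_eq algebra_simps)
  ultimately show ?thesis by auto
qed

text \<open>The truncated term of \<open>posterior_mean_eq\<close> is nonpositive here, so the
  contribution of the partially informed investor must be nonnegative.\<close>

lemma posterior_below:
  assumes W: "W \<in> sets borel" and m: "m = posterior_mean M X I W"
    and "W \<subseteq> {..m}"
  shows "m \<le> expectation X"
proof -
  have "0 \<le> (LINT \<omega>|M. - ((X \<omega> - m) * indicator W (X \<omega>)))"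
    using \<open>W \<subseteq> {..m}\<close> by (intro integral_nonneg_AE AE_I2) (auto simp: indicator_def)
  then have "(LINT \<omega>|M. (X \<omega> - m) * indicator W (X \<omega>)) \<le> 0"
    by (simp only: Bochner_Integration.integral_minus)
  then have "\<beta> * (LINT \<omega>|M. (X \<omega> - m) * indicator W (X \<omega>)) \<le> 0"
    using beta_nonneg by (simp add: mult_nonneg_nonpos)
  then have "0 \<le> (1 - \<beta>) * (expectation X - m)"
    using posterior_mean_eq[OF W m] by linarith
  then show ?thesis using beta_less_1 by (simp add: zero_le_mult_iff)
qed

lemma posterior_above:
  assumes W: "W \<in> sets borel" and m: "m = posterior_mean M X I W"
    and "W \<subseteq> {m..}"
  shows "expectation X \<le> m"
proof -
  have "0 \<le> (LINT \<omega>|M. (X \<omega> - m) * indicator W (X \<omega>))"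
    using \<open>W \<subseteq> {m..}\<close> by (intro integral_nonneg_AE AE_I2) (auto simp: indicator_def)
  then have "0 \<le> \<beta> * (LINT \<omega>|M. (X \<omega> - m) * indicator W (X \<omega>))"
    using beta_nonneg by simp
  then have "(1 - \<beta>) * (expectation X - m) \<le> 0"
    using posterior_mean_eq[OF W m] by linarith
  then show ?thesis using beta_less_1 by (simp add: mult_le_0_iff)
qed

end

section \<open>Matching the equilibrium interval with the thresholds\<close>

theorem corollary1:
  fixes M :: "'a measure"
    and R X :: "'a \<Rightarrow> real" and I :: "'a \<Rightarrow> bool"
    and f g :: "real \<Rightarrow> real" and pos_inf :: "real \<Rightarrow> real" and W :: "real set"
    and \<beta> q r r0 \<mu>0 \<mu>ND pos_part xl xu :: real
  assumes "disclosure_model M R X I f g \<beta> q"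
    and "r0 = prob_space.expectation M R"
    and "\<mu>0 = prob_space.expectation M X"
    and "0 < r"
    and "equilibrium M R X I q r pos_inf pos_part W \<mu>ND"
    and "thresholds (cdf (distr M borel X)) r0 \<mu>0 \<beta> q r xl xu"
  shows "(r < r0 \<longrightarrow>
            {x. misleading M R X r W \<mu>ND x} = {r0 * \<mu>0 / r..xu} - {r0 * \<mu>0 / r}) \<and>
         (r > r0 \<longrightarrow>
            {x. misleading M R X r W \<mu>ND x} = {xl..r0 * \<mu>0 / r} - {r0 * \<mu>0 / r})"
proof -
  interpret disclosure_model M R X I f g \<beta> q by fact
  let ?G = "cdf (distr M borel X)"
  define c where "c = r0 * \<mu>0 / r"
  have W: "W \<in> sets borel" and m: "\<mu>ND = posterior_mean M X I W"
    using assms(5) by (auto simp: equilibrium_def Let_def)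
  have "0 < \<mu>0" using X_mean_pos assms(3) by simp
  have rc: "r * c = r0 * \<mu>0" using \<open>0 < r\<close> by (simp add: c_def)
  have W_eq: "if \<mu>ND \<le> c then W = {\<mu>ND..(2 * c - (1 - q) * \<mu>ND) / (1 + q)}
         else W = {(2 * c - (1 - q) * \<mu>ND) / (1 + q)..\<mu>ND}"
    using withholding_set[OF assms(5) \<open>0 < r\<close>] by (simp add: c_def assms(2,3))
  \<comment> \<open>Dividing by \<open>r\<close> turns the initial price into \<open>c\<close> and
    the price after a simple report into \<open>\<mu>ND\<close>.\<close>
  have misl: "misleading M R X r W \<mu>ND x \<longleftrightarrow>
      x \<in> W \<and> (c < x \<and> \<mu>ND < c \<or> x < c \<and> c < \<mu>ND)" for x
    using \<open>0 < r\<close>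
    by (simp add: misleading_def closing_price_def initial_price_eq Let_def
        flip: assms(2,3) rc)
  have bayes: "(1 - \<beta>) * (\<mu>0 - \<mu>ND) + \<beta> * (LINT \<omega>|M. (X \<omega> - \<mu>ND) * indicator W (X \<omega>)) = 0"
    using posterior_mean_eq[OF W m] assms(3) by simp
  \<comment> \<open>The far end of the withheld interval depends on \<open>\<mu>ND\<close> along a
    line of slope \<open>- k\<close>; the linear threshold condition describes the same
    line.\<close>
  define k where "k = (1 - q) / (1 + q)"
  have k: "0 \<le> k" using q_nonneg q_less_1 by (simp add: k_def)
  have line: "(2 * c - (1 - q) * t) / (1 + q) = 2 * c / (1 + q) - k * t" for t
    by (simp add: k_def diff_divide_distrib[of "2 * c"])
  have le: "xl \<le> xu" using assms(6) by (simp add: thresholds_def)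
  show ?thesis
  proof (intro conjI impI)
    assume "r < r0"
    then have "\<mu>0 < c" using \<open>0 < r\<close> \<open>0 < \<mu>0\<close> by (simp add: c_def field_simps)
    have "\<mu>ND < c"
    proof (rule ccontr)
      assume "\<not> \<mu>ND < c"
      \<comment> \<open>In the borderline case \<open>\<mu>ND = c\<close>, \<open>W_eq\<close> takes
        its first branch; the far end is then also \<open>c\<close>, so \<open>W\<close> is the
        single point \<open>c\<close>.\<close>
      moreover have "(2 * c - (1 - q) * c) / (1 + q) = c"
        using q_nonneg by (simp add: field_simps)
      ultimately have "W \<subseteq> {..\<mu>ND}" using W_eq
        by (cases "\<mu>ND = c") auto
      from posterior_below[OF W m this] show False
        using \<open>\<mu>0 < c\<close> \<open>\<not> \<mu>ND < c\<close> assms(3) by simp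
    qed
    then have W': "W = {\<mu>ND..2 * c / (1 + q) - k * \<mu>ND}" using W_eq line by simp
    have th: "\<beta> * integral {xl..xu} (\<lambda>x. ?G x - ?G xu) - (1 - \<beta>) * (\<mu>0 - xl) = 0"
        "(1 + q) * xu + (1 - q) * xl = 2 * c"
      using assms(6) \<open>r < r0\<close> by (auto simp: thresholds_def c_def)
    have xu: "xu = 2 * c / (1 + q) - k * xl"
      unfolding line[symmetric] using th(2) q_nonneg by (simp add: eq_divide_eq algebra_simps)
    have "\<mu>ND = xl"
    proof (rule threshold_unique[OF X_integrable beta_nonneg beta_less_1 k])
      show "(1 - \<beta>) * (expectation X - \<mu>ND) + \<beta> * (LINT \<omega>|M. (X \<omega> - \<mu>ND) *
          indicator {\<mu>ND..2 * c / (1 + q) - k * \<mu>ND} (X \<omega>)) = 0"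
        using bayes unfolding W' assms(3) .
      show "(1 - \<beta>) * (expectation X - xl) + \<beta> * (LINT \<omega>|M. (X \<omega> - xl) *
          indicator {xl..xu} (X \<omega>)) = 0"
        using th(1) unfolding expectation_excess_eq[OF le] assms(3) by simp
      show "2 * c / (1 + q) - k * \<mu>ND + k * \<mu>ND = xu + k * xl" by (simp add: xu)
    qed
    then have "W = {xl..xu}" by (simp add: W' xu)
    \<comment> \<open>As \<open>\<mu>ND = xl < c\<close>, a simple report lowers the price, so only
      withheld values above \<open>c\<close> mislead; at \<open>c\<close> itself the firm value
      equals the initial price and neither direction is wrong.\<close>
    then show "{x. misleading M R X r W \<mu>ND x} = {r0 * \<mu>0 / r..xu} - {r0 * \<mu>0 / r}"
      unfolding misl c_def[symmetric] using \<open>\<mu>ND < c\<close> \<open>\<mu>ND = xl\<close> by auto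
  next
    assume "r0 < r"
    then have "c < \<mu>0" using \<open>0 < r\<close> \<open>0 < \<mu>0\<close> by (simp add: c_def field_simps)
    have "c < \<mu>ND"
    proof (rule ccontr)
      assume "\<not> c < \<mu>ND"
      \<comment> \<open>The first branch of \<open>W_eq\<close> includes \<open>\<mu>ND = c\<close>,
        so no borderline case arises on this side.\<close>
      then have "W \<subseteq> {\<mu>ND..}" using W_eq by auto
      from posterior_above[OF W m this] show False
        using \<open>c < \<mu>0\<close> \<open>\<not> c < \<mu>ND\<close> assms(3) by simp
    qed
    then have W': "W = {2 * c / (1 + q) - k * \<mu>ND..\<mu>ND}" using W_eq line by simp
    have th: "\<beta> * integral {xl..xu} (\<lambda>x. ?G x - ?G xl) - (1 - \<beta>) * (\<mu>0 - xu) = 0"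
        "(1 - q) * xu + (1 + q) * xl = 2 * c"
      using assms(6) \<open>r0 < r\<close> by (auto simp: thresholds_def c_def)
    have xl: "xl = 2 * c / (1 + q) - k * xu"
      unfolding line[symmetric] using th(2) q_nonneg by (simp add: eq_divide_eq algebra_simps)
    \<comment> \<open>Passing to \<open>- X\<close> turns \<open>\<mu>ND\<close> into the lower end of the withheld interval.\<close>
    have reflect: "(1 - \<beta>) * (expectation (\<lambda>\<omega>. - X \<omega>) - - u) +
        \<beta> * (LINT \<omega>|M. (- X \<omega> - - u) * indicator {-u..-l} (- X \<omega>)) = 0"
      if "(1 - \<beta>) * (\<mu>0 - u) + \<beta> * (LINT \<omega>|M. (X \<omega> - u) * indicator {l..u} (X \<omega>)) = 0" for l u
    proof -
      have "(LINT \<omega>|M. (- X \<omega> - - u) * indicator {-u..-l} (- X \<omega>))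
          = (LINT \<omega>|M. - ((X \<omega> - u) * indicator {l..u} (X \<omega>)))"
        by (rule Bochner_Integration.integral_cong[OF refl]) (auto simp: indicator_def)
      also have "\<dots> = - (LINT \<omega>|M. (X \<omega> - u) * indicator {l..u} (X \<omega>))"
        by (rule Bochner_Integration.integral_minus)
      finally have "(LINT \<omega>|M. (- X \<omega> - - u) * indicator {-u..-l} (- X \<omega>))
          = - (LINT \<omega>|M. (X \<omega> - u) * indicator {l..u} (X \<omega>))" .
      moreover have "expectation (\<lambda>\<omega>. - X \<omega>) - - u = - (\<mu>0 - u)"
        by (simp add: assms(3))
      ultimately show ?thesis using that by (simp only: mult_minus_right)
    qed
    have "- \<mu>ND = - xu"
    proof (rule threshold_unique[OF _ beta_nonneg beta_less_1 k])
      show "integrable M (\<lambda>\<omega>. - X \<omega>)" using X_integrable by simp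
      show "(1 - \<beta>) * (expectation (\<lambda>\<omega>. - X \<omega>) - - \<mu>ND) + \<beta> * (LINT \<omega>|M. (- X \<omega> - - \<mu>ND) *
          indicator {- \<mu>ND..- (2 * c / (1 + q) - k * \<mu>ND)} (- X \<omega>)) = 0"
        by (rule reflect) (use bayes in \<open>simp only: W'\<close>)
      show "(1 - \<beta>) * (expectation (\<lambda>\<omega>. - X \<omega>) - - xu) + \<beta> * (LINT \<omega>|M. (- X \<omega> - - xu) *
          indicator {- xu..- xl} (- X \<omega>)) = 0"
        by (rule reflect) (use th(1) in \<open>simp add: expectation_shortfall_eq[OF le]\<close>)
      \<comment> \<open>Both sides equal \<open>- (2 * c / (1 + q))\<close>: negating both ends
        keeps the slope of the line.\<close>
      show "- (2 * c / (1 + q) - k * \<mu>ND) + k * - \<mu>ND = - xl + k * - xu" by (simp add: xl)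
    qed
    then have "\<mu>ND = xu" by simp
    then have "W = {xl..xu}" by (simp add: W' xl)
    then show "{x. misleading M R X r W \<mu>ND x} = {xl..r0 * \<mu>0 / r} - {r0 * \<mu>0 / r}"
      unfolding misl c_def[symmetric] using \<open>c < \<mu>ND\<close> \<open>\<mu>ND = xu\<close> by auto
  qed
qed

end
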